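(* Let $(S,* )$ be an adequate partial semigroup which is a $1$-CR set in $S$, and let $A$ be a piecewise syndetic subset of $S$. Then $A$ is a $1$-CR set in $S$.
   Context: A partial semigroup is a pair $(S,* )$ where $S$ is a nonempty set and $*$ is an operation defined on a nonempty subset of $S\times S$ such that for all $x,y,z\in S$, $(x*y)*z=x*(y*z)$ in the sense that if either side is defined then so is the other and they are equal. For $a\in S$, $\varphi(a)=\{b\in S: a*b \text{ is defined}\}$; for finite nonempty $F\subseteq S$, $\sigma(F)=\bigcap_{a\in F}\varphi(a)$. $(S,* )$ is adequate if $\sigma(F)\neq\emptyset$ for all finite nonempty $F$. $\mathcal{P}_f(X)$ denotes the set of finite nonempty subsets of $X$. Products $\prod_{t\in H}f(t)$ are computed in increasing order of indices. A sequence $f:\mathbb{N}\to S$ is adequate if (i) for each $H\in\mathcal{P}_f(\mathbb{N})$, $\prod_{t\in H}f(t)$ is defined, and (ii) for each $F\in\mathcal{P}_f(S)$ there is $m\in\mathbb{N}$ such that $\prod_{t\in H}f(t)\in\sigma(F)$ for all $H\in\mathcal{P}_f(\mathbb{N})$ with $\min H\geq m$. $\mathcal{T}$ denotes the set of adequate sequences, and $\mathcal{P}_f(\mathcal{T})_{\leq k}=\{F\in\mathcal{P}_f(\mathcal{T}): |F|\leq k\}$. For $k\in\mathbb{N}$, $A\subseteq S$ is a $k$-CR set if for every $L\in\mathcal{P}_f(S)$ there is $r\in\mathbb{N}$ such that for every $F\in\mathcal{P}_f(\mathcal{T})_{\leq k}$ there exist $m\in\mathbb{N}$, $a\in S^{m+1}$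 and $t(1)<\dots<t(m)\leq r$ in $\mathbb{N}$ such that for all $f\in F$, $a(1)*f(t(1))*a(2)*\dots*a(m)*f(t(m))*a(m+1)$ is defined and lies in $A\cap\sigma(L)$. With $\beta S$ the set of ultrafilters on $S$, $\overline{A}=\{p\in\beta S:A\in p\}$, $\delta S=\bigcap_{F\in\mathcal{P}_f(S)}\overline{\sigma(F)}$, $x^{-1}A=\{y\in\varphi(x):x*y\in A\}$, and $p*q=\{A\subseteq S: \{x\in S: x^{-1}A\in q\}\in p\}$ for $p,q\in\delta S$, $\delta S$ is a compact Hausdorff right topological semigroup with smallest two-sided ideal $K(\delta S)$; $A$ is piecewise syndetic if $\overline{A}\cap K(\delta S)\neq\emptyset$. *)

theory Defs
  imports Main "HOL-Library.FuncSet"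
begin

text \<open>
  A partial operation is a function \<open>mul :: 'a \<Rightarrow> 'a \<Rightarrow> 'a option\<close>, with \<open>None\<close> for an undefined
  product. The natural numbers of the source are the positive integers, here \<open>{1..} :: nat set\<close>.
\<close>

text \<open>In \<open>assoc\<close>, each side is \<open>None\<close> unless both of its products are defined.\<close>

locale partial_semigroup =
  fixes S :: "'a set" and mul :: "'a \<Rightarrow> 'a \<Rightarrow> 'a option"
  assumes carrier_nonempty: "S \<noteq> {}"
    and domain_nonempty: "\<exists>x y. mul x y \<noteq> None"
    and mul_closed: "mul x y = Some z \<Longrightarrow> x \<in> S \<and> y \<in> S \<and> z \<in> S"
    and assoc: "\<lbrakk>x \<in> S; y \<in> S; z \<in> S\<rbrakk> \<Longrightarrow>
      Option.bind (mul x y) (\<lambda>u. mul u z) = Option.bind (mul y z) (\<lambda>v. mul x v)"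

abbreviation Pf :: "'b set \<Rightarrow> 'b set set" where
  "Pf X \<equiv> Fpow X - {{}}"

definition phi :: "'a set \<Rightarrow> ('a \<Rightarrow> 'a \<Rightarrow> 'a option) \<Rightarrow> 'a \<Rightarrow> 'a set" where
  "phi S mul a = {b \<in> S. mul a b \<noteq> None}"

definition sigma :: "'a set \<Rightarrow> ('a \<Rightarrow> 'a \<Rightarrow> 'a option) \<Rightarrow> 'a set \<Rightarrow> 'a set" where
  "sigma S mul F = (\<Inter>a\<in>F. phi S mul a)"

locale adequate_partial_semigroup = partial_semigroup +
  assumes adequate: "F \<in> Pf S \<Longrightarrow> sigma S mul F \<noteq> {}"

text \<open>The product of a nonempty word, bracketed to the left; the empty word has no product.\<close>

fun word_prod :: "('a \<Rightarrow> 'a \<Rightarrow> 'a option) \<Rightarrow> 'a list \<Rightarrow> 'a option" where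
  "word_prod mul [] = None"
| "word_prod mul [x] = Some x"
| "word_prod mul (x # y # zs) = Option.bind (mul x y) (\<lambda>u. word_prod mul (u # zs))"

definition seq_prod :: "('a \<Rightarrow> 'a \<Rightarrow> 'a option) \<Rightarrow> (nat \<Rightarrow> 'a) \<Rightarrow> nat set \<Rightarrow> 'a option" where
  "seq_prod mul f H = word_prod mul (map f (sorted_list_of_set H))"

text \<open>
  The extensional function space makes each sequence indexed by the positive integers a single
  element of \<open>adequate_seqs\<close>, so that cardinalities of sets of sequences are the intended ones.
\<close>

definition adequate_seqs :: "'a set \<Rightarrow> ('a \<Rightarrow> 'a \<Rightarrow> 'a option) \<Rightarrow> (nat \<Rightarrow> 'a) set" where
  "adequate_seqs S mul = {f \<in> {1..} \<rightarrow>\<^sub>E S.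
     (\<forall>H \<in> Pf {1..}. seq_prod mul f H \<noteq> None) \<and>
     (\<forall>F \<in> Pf S. \<exists>m \<in> {1..}. \<forall>H \<in> Pf {1..}. m \<le> Min H \<longrightarrow>
        (\<exists>s \<in> sigma S mul F. seq_prod mul f H = Some s))}"

definition CR_set :: "'a set \<Rightarrow> ('a \<Rightarrow> 'a \<Rightarrow> 'a option) \<Rightarrow> nat \<Rightarrow> 'a set \<Rightarrow> bool" where
  "CR_set S mul k A \<longleftrightarrow> A \<subseteq> S \<and>
     (\<forall>L \<in> Pf S. \<exists>r \<in> {1..}. \<forall>F \<in> Pf (adequate_seqs S mul). card F \<le> k \<longrightarrow>
        (\<exists>m \<in> {1..}. \<exists>a \<in> {1..m + 1} \<rightarrow> S. \<exists>t \<in> {1..m} \<rightarrow> {1..r}.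
           strict_mono_on {1..m} t \<and>
           (\<forall>f \<in> F. \<exists>s \<in> A \<inter> sigma S mul L.
              word_prod mul (concat (map (\<lambda>i. [a i, f (t i)]) [1..<m + 1]) @ [a (m + 1)])
                = Some s)))"

definition ultrafilters :: "'a set \<Rightarrow> 'a set set set" where
  "ultrafilters S = {p. p \<subseteq> Pow S \<and> S \<in> p \<and> {} \<notin> p \<and>
     (\<forall>A\<in>p. \<forall>B\<in>p. A \<inter> B \<in> p) \<and>
     (\<forall>A\<in>p. \<forall>B. A \<subseteq> B \<and> B \<subseteq> S \<longrightarrow> B \<in> p) \<and>
     (\<forall>A. A \<subseteq> S \<longrightarrow> A \<in> p \<or> S - A \<in> p)}"

definition uf_closure :: "'a set \<Rightarrow> 'a set \<Rightarrow> 'a set set set" where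
  "uf_closure S A = {p \<in> ultrafilters S. A \<in> p}"

definition delta :: "'a set \<Rightarrow> ('a \<Rightarrow> 'a \<Rightarrow> 'a option) \<Rightarrow> 'a set set set" where
  "delta S mul = (\<Inter>F \<in> Pf S. uf_closure S (sigma S mul F))"

definition left_quotient ::
    "'a set \<Rightarrow> ('a \<Rightarrow> 'a \<Rightarrow> 'a option) \<Rightarrow> 'a \<Rightarrow> 'a set \<Rightarrow> 'a set" where
  "left_quotient S mul x A = {y \<in> phi S mul x. \<exists>z \<in> A. mul x y = Some z}"

definition uf_mult ::
    "'a set \<Rightarrow> ('a \<Rightarrow> 'a \<Rightarrow> 'a option) \<Rightarrow> 'a set set \<Rightarrow> 'a set set \<Rightarrow> 'a set set" where
  "uf_mult S mul p q = {A. A \<subseteq> S \<and> {x \<in> S. left_quotient S mul x A \<in> q} \<in> p}"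

definition two_sided_ideal ::
    "'a set \<Rightarrow> ('a \<Rightarrow> 'a \<Rightarrow> 'a option) \<Rightarrow> 'a set set set \<Rightarrow> bool" where
  "two_sided_ideal S mul I \<longleftrightarrow> I \<noteq> {} \<and> I \<subseteq> delta S mul \<and>
     (\<forall>p \<in> delta S mul. \<forall>q \<in> I. uf_mult S mul p q \<in> I \<and> uf_mult S mul q p \<in> I)"

text \<open>
  \<open>LEAST\<close> refers to inclusion. In the adequate case the smallest ideal exists, since \<open>delta S mul\<close>
  is a compact right topological semigroup.
\<close>

definition smallest_ideal :: "'a set \<Rightarrow> ('a \<Rightarrow> 'a \<Rightarrow> 'a option) \<Rightarrow> 'a set set set" where
  "smallest_ideal S mul = (LEAST I. two_sided_ideal S mul I)"

definition piecewise_syndetic :: "'a set \<Rightarrow> ('a \<Rightarrow> 'a \<Rightarrow> 'a option) \<Rightarrow> 'a set \<Rightarrow> bool" where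
  "piecewise_syndetic S mul A \<longleftrightarrow> A \<subseteq> S \<and> uf_closure S A \<inter> smallest_ideal S mul \<noteq> {}"

end

theory Submission
  imports Defs
begin

text \<open>
  The set of all \<open>p\<close> such that every \<open>q\<close> admits an \<open>r\<close> with \<open>r * (q * p) = p\<close> is the smallest
  ideal of \<open>\<delta>S\<close>: it is a two-sided ideal contained in every other one by associativity alone, and
  compactness is only used to see that it is nonempty. Let \<open>p\<close> be such an ultrafilter containing
  \<open>A\<close>, and let \<open>L\<close> be finite. Then \<open>A' = A \<inter> \<sigma>(L)\<close> lies in \<open>p\<close>; put \<open>B = {x. x\<^sup>-\<^sup>1A' \<in> p}\<close>. Every
  \<open>q \<in> \<delta>S\<close> contains some \<open>x\<^sup>-\<^sup>1B\<close>, so by compactness there is a finite \<open>F\<close> such that every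
  \<open>y \<in> \<sigma>(F)\<close> has some \<open>x\<close> with \<open>x * y \<in> B\<close>, hence some \<open>z\<close> with \<open>x * y * z \<in> A'\<close>. Apply this to
  the words \<open>y = a(1) * f(t(1)) * \<dots> * a(m+1)\<close> in \<open>\<sigma>(F)\<close> provided by the 1-CR property of \<open>S\<close>,
  and absorb \<open>x\<close> into \<open>a(1)\<close> and \<open>z\<close> into \<open>a(m+1)\<close>; the bound \<open>r\<close> for \<open>S\<close> and \<open>F\<close> is kept.
\<close>

section \<open>Ultrafilters\<close>

text \<open>Ultrafilter lemma, by Zorn's lemma on the families with the finite intersection
  property. The factor \<open>S\<close> covers the empty \<open>\<G>\<close>, whose intersection is
  the whole type.\<close>

lemma ultrafilter_extends_fip:
  assumes sub: "\<F> \<subseteq> Pow S"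
    and fip: "\<And>\<G>. \<lbrakk>finite \<G>; \<G> \<subseteq> \<F>\<rbrakk> \<Longrightarrow> S \<inter> \<Inter>\<G> \<noteq> {}"
  shows "\<exists>p \<in> ultrafilters S. \<F> \<subseteq> p"
proof -
  define W where "W = {\<H>. \<F> \<subseteq> \<H> \<and> \<H> \<subseteq> Pow S \<and> (\<forall>\<G>. finite \<G> \<and> \<G> \<subseteq> \<H> \<longrightarrow> S \<inter> \<Inter>\<G> \<noteq> {})}"
  have "\<exists>p\<in>W. \<forall>X\<in>W. p \<subseteq> X \<longrightarrow> X = p"
  proof (rule subset_Zorn_nonempty)
    show "W \<noteq> {}" using sub fip unfolding W_def by blast
    fix C assume C: "C \<noteq> {}" "subset.chain W C"
    have CW: "C \<subseteq> W" using C(2) by (simp add: subset.chain_def)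
    have "S \<inter> \<Inter>\<G> \<noteq> {}" if g: "finite \<G>" "\<G> \<subseteq> \<Union>C" for \<G>
    proof -
      obtain \<H> where "\<H> \<in> C" "\<G> \<subseteq> \<H>" using finite_subset_Union_chain[OF g C] by blast
      then have "\<H> \<in> W" using CW by blast
      then show ?thesis using \<open>\<G> \<subseteq> \<H>\<close> g(1) by (simp add: W_def)
    qed
    moreover have "\<forall>\<H>\<in>C. \<F> \<subseteq> \<H> \<and> \<H> \<subseteq> Pow S" using CW unfolding W_def by blast
    then have "\<F> \<subseteq> \<Union>C" "\<Union>C \<subseteq> Pow S" using C(1) by blast+
    ultimately show "\<Union>C \<in> W" by (simp add: W_def)
  qed
  then obtain p where p: "p \<in> W" and max: "\<And>X. X \<in> W \<Longrightarrow> p \<subseteq> X \<Longrightarrow> X = p" by blast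
  have pfip: "S \<inter> \<Inter>\<G> \<noteq> {}" if "finite \<G>" "\<G> \<subseteq> p" for \<G>
    using p that unfolding W_def by blast
  have pS: "\<F> \<subseteq> p" "p \<subseteq> Pow S" using p unfolding W_def by auto
  \<comment> \<open>Maximality in usable form: such an \<open>X\<close> can be adjoined to
    \<open>p\<close> without leaving \<open>W\<close>. The closure properties of \<open>p\<close>
    below reduce to this.\<close>
  have mem: "X \<in> p"
    if X: "X \<subseteq> S" "\<And>\<G>. \<lbrakk>finite \<G>; \<G> \<subseteq> p\<rbrakk> \<Longrightarrow> X \<inter> \<Inter>\<G> \<noteq> {}" for X
  proof -
    have "S \<inter> \<Inter>\<G> \<noteq> {}" if g: "finite \<G>" "\<G> \<subseteq> insert X p" for \<G>
    proof -
      have "X \<inter> \<Inter>(\<G> - {X}) \<noteq> {}" using X(2)[of "\<G> - {X}"] g by blast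
      then show ?thesis using X(1) by blast
    qed
    then have "insert X p \<in> W" unfolding W_def using pS X(1) by auto
    then show ?thesis using max by blast
  qed
  have "A \<inter> B \<in> p" if "A \<in> p" "B \<in> p" for A B
  proof (rule mem)
    fix \<G> assume "finite \<G>" "\<G> \<subseteq> p"
    then have "S \<inter> \<Inter>(insert A (insert B \<G>)) \<noteq> {}" using that by (intro pfip) auto
    then show "(A \<inter> B) \<inter> \<Inter>\<G> \<noteq> {}" by auto
  qed (use that pS in auto)
  moreover have "B \<in> p" if "A \<in> p" "A \<subseteq> B" "B \<subseteq> S" for A B
  proof (rule mem)
    fix \<G> assume "finite \<G>" "\<G> \<subseteq> p"
    then have "S \<inter> \<Inter>(insert A \<G>) \<noteq> {}" using that by (intro pfip) auto
    then show "B \<inter> \<Inter>\<G> \<noteq> {}" using that by auto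
  qed (use that in auto)
  moreover have "A \<in> p \<or> S - A \<in> p" if A: "A \<subseteq> S" for A
  proof (rule ccontr)
    assume n: "\<not> (A \<in> p \<or> S - A \<in> p)"
    \<comment> \<open>If neither \<open>A\<close> nor its complement can be adjoined, two finite
      subfamilies witness this, and their union has no common point in \<open>S\<close>.\<close>
    obtain \<G>1 where 1: "finite \<G>1" "\<G>1 \<subseteq> p" "A \<inter> \<Inter>\<G>1 = {}" using mem[of A] n A by blast
    obtain \<G>2 where 2: "finite \<G>2" "\<G>2 \<subseteq> p" "(S - A) \<inter> \<Inter>\<G>2 = {}"
      using mem[of "S - A"] n by blast
    have "S \<inter> \<Inter>(\<G>1 \<union> \<G>2) \<noteq> {}" by (rule pfip) (use 1 2 in auto)
    then show False using 1 2 by blast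
  qed
  moreover have "S \<in> p" by (rule mem) (use pfip in auto)
  moreover have "{} \<notin> p" using pfip[of "{{}}"] by auto
  ultimately have "p \<in> ultrafilters S" using pS(2) unfolding ultrafilters_def by simp
  then show ?thesis using pS(1) by blast
qed

section \<open>Elementary calculus of ultrafilters\<close>

lemma ultrafilter_sub: "p \<in> ultrafilters S \<Longrightarrow> A \<in> p \<Longrightarrow> A \<subseteq> S"
  by (auto simp: ultrafilters_def)

lemma ultrafilter_Int: "p \<in> ultrafilters S \<Longrightarrow> A \<in> p \<Longrightarrow> B \<in> p \<Longrightarrow> A \<inter> B \<in> p"
  by (simp add: ultrafilters_def)

lemma ultrafilter_mono: "p \<in> ultrafilters S \<Longrightarrow> A \<in> p \<Longrightarrow> A \<subseteq> B \<Longrightarrow> B \<subseteq> S \<Longrightarrow> B \<in> p"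
  by (simp add: ultrafilters_def)

lemma ultrafilter_nonempty: "p \<in> ultrafilters S \<Longrightarrow> A \<in> p \<Longrightarrow> A \<noteq> {}"
  by (auto simp: ultrafilters_def)

lemma ultrafilter_top: "p \<in> ultrafilters S \<Longrightarrow> S \<in> p"
  by (simp add: ultrafilters_def)

lemma ultrafilter_Diff:
  assumes p: "p \<in> ultrafilters S" and A: "A \<subseteq> S"
  shows "S - A \<in> p \<longleftrightarrow> A \<notin> p"
proof
  assume "S - A \<in> p"
  then have "A \<in> p \<Longrightarrow> A \<inter> (S - A) \<in> p" by (rule ultrafilter_Int[OF p, rotated])
  then show "A \<notin> p" using ultrafilter_nonempty[OF p] by auto
next
  have "\<forall>A. A \<subseteq> S \<longrightarrow> A \<in> p \<or> S - A \<in> p" using p by (simp add: ultrafilters_def)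
  then show "A \<notin> p \<Longrightarrow> S - A \<in> p" using A by blast
qed

lemma ultrafilter_Int_iff:
  assumes p: "p \<in> ultrafilters S" and "A \<subseteq> S" "B \<subseteq> S"
  shows "A \<inter> B \<in> p \<longleftrightarrow> A \<in> p \<and> B \<in> p"
proof
  assume "A \<inter> B \<in> p"
  then show "A \<in> p \<and> B \<in> p"
    using ultrafilter_mono[OF p _ Int_lower1 assms(2)] ultrafilter_mono[OF p _ Int_lower2 assms(3)]
    by simp
qed (simp add: ultrafilter_Int[OF p])

lemma ultrafilter_Inter:
  assumes "p \<in> ultrafilters S" "finite \<G>" "\<G> \<subseteq> p"
  shows "S \<inter> \<Inter>\<G> \<in> p"
  using assms(2,3)
proof (induction \<G>)
  case empty
  then show ?case using ultrafilter_top[OF assms(1)] by simp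
next
  case (insert X \<G>)
  then have "X \<inter> (S \<inter> \<Inter>\<G>) \<in> p" using ultrafilter_Int[OF assms(1)] by simp
  then show ?case by (simp add: Int_left_commute)
qed

lemma ultrafilter_eqI:
  assumes "p \<in> ultrafilters S" "q \<in> ultrafilters S" "p \<subseteq> q"
  shows "p = q"
proof
  show "q \<subseteq> p"
  proof
    fix A assume A: "A \<in> q"
    then have "A \<subseteq> S" "S - A \<notin> q"
      using ultrafilter_sub[OF assms(2)] ultrafilter_Diff[OF assms(2)] by auto
    then show "A \<in> p" using ultrafilter_Diff[OF assms(1)] assms(3) by auto
  qed
qed (rule assms(3))

section \<open>The semigroup of ultrafilters\<close>

context adequate_partial_semigroup
begin

abbreviation uf_times (infixl "\<star>" 70) where "p \<star> q \<equiv> uf_mult S mul p q"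
abbreviation "\<Delta> \<equiv> delta S mul"
abbreviation "lq \<equiv> left_quotient S mul"
abbreviation "sg \<equiv> sigma S mul"

section \<open>Membership in \<open>\<Delta>\<close> and its compactness\<close>

lemma phi_sub: "phi S mul x \<subseteq> S"
  unfolding phi_def by auto

lemma lq_sub: "lq x A \<subseteq> S"
  unfolding left_quotient_def phi_def by auto

lemma lq_iff: "y \<in> lq x A \<longleftrightarrow> (\<exists>z\<in>A. mul x y = Some z)"
  unfolding left_quotient_def phi_def using mul_closed by fastforce

lemma sigma_iff: "L \<noteq> {} \<Longrightarrow> y \<in> sg L \<longleftrightarrow> y \<in> S \<and> (\<forall>a\<in>L. mul a y \<noteq> None)"
  unfolding sigma_def phi_def by auto

lemma sigma_sub: "L \<noteq> {} \<Longrightarrow> sg L \<subseteq> S"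
  using sigma_iff by blast

lemma Fpow_iff: "L \<in> Fpow S \<longleftrightarrow> finite L \<and> L \<subseteq> S"
  unfolding Fpow_def by auto

lemma Pf_carrier_nonempty: "Pf S \<noteq> {}"
proof -
  obtain s where "s \<in> S" using carrier_nonempty by blast
  then have "{s} \<in> Pf S" by (simp add: Fpow_iff)
  then show ?thesis by blast
qed

text \<open>\<open>delta\<close> is an intersection indexed by \<open>Pf S\<close>; that this index
  set is nonempty is what makes every member an ultrafilter.\<close>

lemma delta_iff: "p \<in> \<Delta> \<longleftrightarrow> p \<in> ultrafilters S \<and> (\<forall>L\<in>Pf S. sg L \<in> p)"
  unfolding delta_def uf_closure_def using Pf_carrier_nonempty by blast

lemma delta_ultrafilter: "p \<in> \<Delta> \<Longrightarrow> p \<in> ultrafilters S"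
  by (simp add: delta_iff)

lemma phi_mem_delta: "p \<in> \<Delta> \<Longrightarrow> x \<in> S \<Longrightarrow> phi S mul x \<in> p"
proof -
  assume "p \<in> \<Delta>" "x \<in> S"
  then have "sg {x} \<in> p" by (auto simp: delta_iff Fpow_iff)
  then show ?thesis by (simp add: sigma_def)
qed

text \<open>Compactness of \<open>\<Delta>\<close>: the sets \<open>sg L\<close> are adjoined to
  \<open>\<F>\<close>, and finitely many of them contain a single one, indexed by the union of the
  \<open>L\<close>.\<close>

lemma delta_extends:
  assumes sub: "\<F> \<subseteq> Pow S"
    and fip: "\<And>\<G> L. \<lbrakk>finite \<G>; \<G> \<subseteq> \<F>; L \<in> Pf S\<rbrakk> \<Longrightarrow> sg L \<inter> \<Inter>\<G> \<noteq> {}"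
  shows "\<exists>p \<in> \<Delta>. \<F> \<subseteq> p"
proof -
  have "\<exists>p \<in> ultrafilters S. \<F> \<union> sg ` Pf S \<subseteq> p"
  proof (rule ultrafilter_extends_fip)
    show "\<F> \<union> sg ` Pf S \<subseteq> Pow S" using sub sigma_sub by (auto simp: Fpow_iff)
    fix \<G> assume g: "finite \<G>" "\<G> \<subseteq> \<F> \<union> sg ` Pf S"
    have "finite (\<G> - \<F>)" "\<G> - \<F> \<subseteq> sg ` Pf S" using g by auto
    then obtain \<L> where \<L>: "\<L> \<subseteq> Pf S" "finite \<L>" "\<G> - \<F> = sg ` \<L>"
      by (meson finite_subset_image)
    \<comment> \<open>Adjoining \<open>s\<close> keeps the index set nonempty when no
      \<open>sg M\<close> occurs, that is, when \<open>\<L>\<close> is empty.\<close>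
    obtain s where s: "s \<in> S" using carrier_nonempty by blast
    have "\<forall>M\<in>\<L>. finite M \<and> M \<subseteq> S" using \<L>(1) Fpow_iff by blast
    then have L: "insert s (\<Union>\<L>) \<in> Pf S" using \<L>(2) s by (auto simp: Fpow_iff)
    have "sg (insert s (\<Union>\<L>)) \<inter> \<Inter>(\<G> \<inter> \<F>) \<noteq> {}" using fip L g by blast
    then obtain y where y: "y \<in> sg (insert s (\<Union>\<L>))" "y \<in> \<Inter>(\<G> \<inter> \<F>)" by blast
    have "y \<in> X" if "X \<in> \<G>" for X
    proof (cases "X \<in> \<F>")
      case False
      then have "X \<in> sg ` \<L>" using \<L>(3) that by blast
      then obtain M where "M \<in> \<L>" "X = sg M" by blast
      then show ?thesis using y(1) by (auto simp: sigma_def)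
    qed (use y that in blast)
    moreover have "y \<in> S" using y(1) by (simp add: sigma_iff)
    ultimately show "S \<inter> \<Inter>\<G> \<noteq> {}" by blast
  qed
  then obtain p where p: "p \<in> ultrafilters S" "\<F> \<subseteq> p" "sg ` Pf S \<subseteq> p" by blast
  then have "p \<in> \<Delta>" unfolding delta_iff by blast
  then show ?thesis using p(2) by blast
qed

section \<open>The product on \<open>\<Delta>\<close>: closure and associativity\<close>

lemma uf_mult_iff: "A \<in> p \<star> q \<longleftrightarrow> A \<subseteq> S \<and> {x \<in> S. lq x A \<in> q} \<in> p"
  unfolding uf_mult_def by simp

lemma lq_Int: "lq x (A \<inter> B) = lq x A \<inter> lq x B"
  by (auto simp: lq_iff)

text \<open>The factor \<open>phi S mul x\<close> removes the points at which the product is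
  undefined; since it belongs to every member of \<open>\<Delta>\<close>, complements still pass
  through the product.\<close>

lemma lq_Diff: "lq x (S - A) = phi S mul x \<inter> (S - lq x A)"
  using mul_closed by (fastforce simp: lq_iff phi_def)

lemma lq_mono: "A \<subseteq> B \<Longrightarrow> lq x A \<subseteq> lq x B"
  unfolding left_quotient_def by blast

lemma uf_mult_Int:
  assumes p: "p \<in> \<Delta>" and q: "q \<in> \<Delta>" and "A \<in> p \<star> q" "B \<in> p \<star> q"
  shows "A \<inter> B \<in> p \<star> q"
proof -
  have "{x \<in> S. lq x (A \<inter> B) \<in> q} = {x \<in> S. lq x A \<in> q} \<inter> {x \<in> S. lq x B \<in> q}"
    using ultrafilter_Int_iff[OF delta_ultrafilter[OF q] lq_sub lq_sub] by (auto simp: lq_Int)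
  then show ?thesis
    using assms ultrafilter_Int[OF delta_ultrafilter[OF p]] by (auto simp: uf_mult_iff)
qed

lemma uf_mult_Diff:
  assumes p: "p \<in> \<Delta>" and q: "q \<in> \<Delta>" and A: "A \<subseteq> S"
  shows "S - A \<in> p \<star> q \<longleftrightarrow> A \<notin> p \<star> q"
proof -
  have "lq x (S - A) \<in> q \<longleftrightarrow> lq x A \<notin> q" if "x \<in> S" for x
    using ultrafilter_Int_iff[OF delta_ultrafilter[OF q] phi_sub, of "S - lq x A" x]
      ultrafilter_Diff[OF delta_ultrafilter[OF q] lq_sub] phi_mem_delta[OF q that]
    by (simp add: lq_Diff)
  then have "{x \<in> S. lq x (S - A) \<in> q} = S - {x \<in> S. lq x A \<in> q}" by blast
  then show ?thesis
    using A ultrafilter_Diff[OF delta_ultrafilter[OF p], of "{x \<in> S. lq x A \<in> q}"]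
    by (auto simp: uf_mult_iff)
qed

text \<open>For \<open>x \<in> sg L\<close> all products in \<open>L * x\<close>, the set
  \<open>M\<close> below, are defined. By associativity, \<open>y \<in> sg M\<close> gives
  \<open>x * y \<in> sg L\<close>, and \<open>sg M \<in> q\<close>.\<close>

lemma uf_mult_sigma:
  assumes p: "p \<in> \<Delta>" and q: "q \<in> \<Delta>" and L: "L \<in> Pf S"
  shows "sg L \<in> p \<star> q"
proof -
  have L': "L \<noteq> {}" "L \<subseteq> S" "finite L" using L by (auto simp: Fpow_iff)
  have "lq x (sg L) \<in> q" if x: "x \<in> sg L" for x
  proof -
    have xS: "x \<in> S" and def: "\<And>a. a \<in> L \<Longrightarrow> mul a x \<noteq> None"
      using x L' by (auto simp: sigma_iff)
    define M where "M = (\<lambda>a. the (mul a x)) ` L"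
    have "M \<subseteq> S" unfolding M_def using def mul_closed by fastforce
    then have "M \<in> Pf S" using L' unfolding M_def by (simp add: Fpow_iff)
    then have M: "sg M \<in> q" "M \<noteq> {}" using q by (auto simp: delta_iff Fpow_iff)
    have "sg M \<subseteq> lq x (sg L)"
    proof
      fix y assume "y \<in> sg M"
      then have y: "y \<in> S" "\<And>a. a \<in> L \<Longrightarrow> mul (the (mul a x)) y \<noteq> None"
        using M(2) by (auto simp: sigma_iff M_def)
      have xy: "\<exists>v. mul x y = Some v \<and> mul a v \<noteq> None" if a: "a \<in> L" for a
      proof -
        obtain u where u: "mul a x = Some u" using def a by blast
        have "Option.bind (mul a x) (\<lambda>u. mul u y) = Option.bind (mul x y) (\<lambda>v. mul a v)"
          by (rule assoc) (use a L' xS y in auto)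
        then show ?thesis using u y(2)[OF a] by (cases "mul x y") auto
      qed
      \<comment> \<open>Some \<open>a \<in> L\<close> is needed here to read off that
        \<open>x * y\<close> is defined.\<close>
      then obtain v where v: "mul x y = Some v" using L'(1) by blast
      then have "v \<in> sg L" using xy mul_closed unfolding sigma_iff[OF L'(1)] by fastforce
      then show "y \<in> lq x (sg L)" using v by (auto simp: lq_iff)
    qed
    then show ?thesis using ultrafilter_mono[OF delta_ultrafilter[OF q] M(1)] lq_sub by blast
  qed
  then have "sg L \<subseteq> {x \<in> S. lq x (sg L) \<in> q}" using sigma_sub[OF L'(1)] by blast
  moreover have "sg L \<in> p" using p L by (simp add: delta_iff)
  ultimately have "{x \<in> S. lq x (sg L) \<in> q} \<in> p"
    using ultrafilter_mono[OF delta_ultrafilter[OF p]] by auto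
  then show ?thesis using sigma_sub[OF L'(1)] by (simp add: uf_mult_iff)
qed

lemma uf_mult_closed:
  assumes p: "p \<in> \<Delta>" and q: "q \<in> \<Delta>"
  shows "p \<star> q \<in> \<Delta>"
proof -
  note pU = delta_ultrafilter[OF p] and qU = delta_ultrafilter[OF q]
  have mono: "B \<in> p \<star> q" if "A \<in> p \<star> q" "A \<subseteq> B" "B \<subseteq> S" for A B
  proof -
    have "{x \<in> S. lq x A \<in> q} \<subseteq> {x \<in> S. lq x B \<in> q}"
      using ultrafilter_mono[OF qU _ lq_mono[OF that(2)] lq_sub] by auto
    moreover have "{x \<in> S. lq x A \<in> q} \<in> p" using that(1) by (simp add: uf_mult_iff)
    ultimately have "{x \<in> S. lq x B \<in> q} \<in> p" using ultrafilter_mono[OF pU] by auto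
    then show ?thesis using that(3) by (simp add: uf_mult_iff)
  qed
  have empty: "{} \<notin> p \<star> q"
  proof -
    have "lq x {} = {}" for x by (auto simp: lq_iff)
    moreover have "{} \<notin> p" "{} \<notin> q" using ultrafilter_nonempty pU qU by blast+
    ultimately show ?thesis by (simp add: uf_mult_iff)
  qed
  then have top: "S \<in> p \<star> q" using uf_mult_Diff[OF p q, of "{}"] by simp
  have sub: "p \<star> q \<subseteq> Pow S" by (auto simp: uf_mult_iff)
  have "p \<star> q \<in> ultrafilters S"
    unfolding ultrafilters_def
    using mono empty top sub uf_mult_Int[OF p q] uf_mult_Diff[OF p q] by simp
  then show ?thesis using uf_mult_sigma[OF p q] by (simp add: delta_iff)
qed

text \<open>Associativity for preimages. If \<open>y * z\<close> is undefined, then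
  \<open>y * (z * w)\<close> is undefined for every \<open>w\<close>, which accounts for the empty
  set.\<close>

lemma lq_lq:
  assumes "y \<in> S" "z \<in> S"
  shows "lq z (lq y A) = (case mul y z of None \<Rightarrow> {} | Some u \<Rightarrow> lq u A)"
proof -
  have "w \<in> lq z (lq y A) \<longleftrightarrow> (\<exists>u. mul y z = Some u \<and> w \<in> lq u A)" for w
  proof (cases "w \<in> S")
    case True
    show ?thesis
      using assoc[OF assms True] by (cases "mul z w"; cases "mul y z") (auto simp: lq_iff)
  qed (use lq_sub in blast)
  then show ?thesis by (auto split: option.splits)
qed

text \<open>By \<open>lq_lq\<close>; a \<open>z\<close> with \<open>y * z\<close> undefined drops
  out on the right as well, because the empty set is not in \<open>r\<close>.\<close>

lemma lq_uf_mult: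
  assumes r: "r \<in> \<Delta>" and y: "y \<in> S"
  shows "lq y {x \<in> S. lq x A \<in> r} = {z \<in> S. lq z (lq y A) \<in> r}"
proof -
  have "{} \<notin> r" using ultrafilter_nonempty[OF delta_ultrafilter[OF r]] by blast
  then show ?thesis
    using y mul_closed by (fastforce simp: lq_iff lq_lq split: option.splits)
qed

lemma uf_mult_assoc:
  assumes "r \<in> \<Delta>"
  shows "(p \<star> q) \<star> r = p \<star> (q \<star> r)"
proof -
  have "A \<in> (p \<star> q) \<star> r \<longleftrightarrow> A \<in> p \<star> (q \<star> r)" for A
  proof -
    have "{y \<in> S. lq y {x \<in> S. lq x A \<in> r} \<in> q} = {y \<in> S. {z \<in> S. lq z (lq y A) \<in> r} \<in> q}"
      using lq_uf_mult[OF assms] by auto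
    then show ?thesis using lq_sub by (simp add: uf_mult_iff)
  qed
  then show ?thesis by blast
qed

section \<open>The smallest ideal\<close>

text \<open>The left ideal \<open>\<Delta> \<star> p\<close> is closed, being the image of a compact
  space under the continuous map \<open>r \<mapsto> r \<star> p\<close>. Hypothesis
  \<open>sub\<close> says that \<open>q\<close> lies in its closure; compactness yields an
  \<open>r\<close> satisfying \<open>{x \<in> S. lq x A \<in> p} \<in> r\<close> for all
  \<open>A \<in> q\<close>.\<close>

lemma principal_left_ideal_closed:
  assumes q: "q \<in> \<Delta>" and p: "p \<in> \<Delta>"
    and sub: "{A. A \<subseteq> S \<and> (\<forall>r\<in>\<Delta>. A \<in> r \<star> p)} \<subseteq> q"
  shows "\<exists>r\<in>\<Delta>. q = r \<star> p"
proof -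
  define \<F> where "\<F> = (\<lambda>A. {x \<in> S. lq x A \<in> p}) ` q"
  have "\<exists>r\<in>\<Delta>. \<F> \<subseteq> r"
  proof (rule delta_extends)
    show "\<F> \<subseteq> Pow S" unfolding \<F>_def by auto
    fix \<G> L assume g: "finite \<G>" "\<G> \<subseteq> \<F>" and L: "L \<in> Pf S"
    obtain Q where Q: "Q \<subseteq> q" "finite Q" "\<G> = (\<lambda>A. {x \<in> S. lq x A \<in> p}) ` Q"
      using g unfolding \<F>_def by (meson finite_subset_image)
    define A where "A = S \<inter> \<Inter>Q"
    have A: "A \<in> q" "A \<subseteq> S"
      using ultrafilter_Inter[OF delta_ultrafilter[OF q] Q(2,1)] by (auto simp: A_def)
    \<comment> \<open>Otherwise \<open>S - A\<close> belongs to every \<open>r \<star> p\<close>,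
      hence to \<open>q\<close> by \<open>sub\<close>.\<close>
    have "\<exists>r\<in>\<Delta>. A \<in> r \<star> p"
    proof (rule ccontr)
      assume "\<not> ?thesis"
      then have "S - A \<in> q" using uf_mult_Diff[OF _ p A(2)] sub by blast
      then show False using A ultrafilter_Diff[OF delta_ultrafilter[OF q]] by blast
    qed
    then obtain r where r: "r \<in> \<Delta>" "{x \<in> S. lq x A \<in> p} \<in> r" by (auto simp: uf_mult_iff)
    have "sg L \<inter> {x \<in> S. lq x A \<in> p} \<in> r"
      using ultrafilter_Int[OF delta_ultrafilter[OF r(1)]] r L by (auto simp: delta_iff)
    then obtain x where x: "x \<in> sg L" "x \<in> S" "lq x A \<in> p"
      using ultrafilter_nonempty[OF delta_ultrafilter[OF r(1)]] by blast
    have "lq x X \<in> p" if "X \<in> Q" for X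
      using ultrafilter_mono[OF delta_ultrafilter[OF p] x(3) lq_mono lq_sub] that
      by (auto simp: A_def)
    then show "sg L \<inter> \<Inter>\<G> \<noteq> {}" using x Q(3) by blast
  qed
  then obtain r where r: "r \<in> \<Delta>" "\<F> \<subseteq> r" by blast
  then have "q \<subseteq> r \<star> p"
    using ultrafilter_sub[OF delta_ultrafilter[OF q]] unfolding uf_mult_iff \<F>_def subset_iff
    by blast
  then show ?thesis
    using ultrafilter_eqI delta_ultrafilter uf_mult_closed q r(1) p by blast
qed

text \<open>The elements of the minimal left ideals: \<open>p\<close> lies in every left ideal
  \<open>\<Delta> \<star> (q \<star> p)\<close>, so no left ideal is properly contained in
  \<open>\<Delta> \<star> p\<close>.\<close>

definition minimal_elements :: "'a set set set" where
  "minimal_elements = {p \<in> \<Delta>. \<forall>q\<in>\<Delta>. \<exists>r\<in>\<Delta>. r \<star> (q \<star> p) = p}"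

text \<open>
  Closed subsets of \<open>\<delta>S\<close> are encoded as \<open>V \<F>\<close> for families \<open>\<F>\<close> of subsets of \<open>S\<close>. A maximal
  family among those encoding a nonempty left ideal yields a minimal closed left ideal.
\<close>

lemma minimal_elements_nonempty: "minimal_elements \<noteq> {}"
proof -
  define V where "V \<F> = {p \<in> \<Delta>. \<F> \<subseteq> p}" for \<F>
  define W where
    "W = {\<F>. \<F> \<subseteq> Pow S \<and> V \<F> \<noteq> {} \<and> (\<forall>p\<in>V \<F>. \<forall>q\<in>\<Delta>. q \<star> p \<in> V \<F>)}"
  have "\<exists>\<F>\<in>W. \<forall>X\<in>W. \<F> \<subseteq> X \<longrightarrow> X = \<F>"
  proof (rule subset_Zorn_nonempty)
    \<comment> \<open>\<open>V {}\<close> is all of \<open>\<Delta>\<close>; adequacy makes it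
      nonempty.\<close>
    have "\<exists>p\<in>\<Delta>. {} \<subseteq> p" by (rule delta_extends) (use adequate in auto)
    then have "{} \<in> W" unfolding W_def V_def using uf_mult_closed by auto
    then show "W \<noteq> {}" by blast
    fix C assume C: "C \<noteq> {}" "subset.chain W C"
    have CW: "C \<subseteq> W" using C(2) by (simp add: subset.chain_def)
    \<comment> \<open>\<open>V (\<Union>C)\<close> is the intersection of a chain of nonempty closed
      left ideals, so compactness applies.\<close>
    have "\<exists>p\<in>\<Delta>. \<Union>C \<subseteq> p"
    proof (rule delta_extends)
      show "\<Union>C \<subseteq> Pow S" using CW unfolding W_def by blast
      fix \<G> L assume g: "finite \<G>" "\<G> \<subseteq> \<Union>C" and L: "L \<in> Pf S"
      obtain \<F> where "\<F> \<in> C" "\<G> \<subseteq> \<F>" using finite_subset_Union_chain[OF g C] by blast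
      moreover from this have "V \<F> \<noteq> {}" using CW unfolding W_def by auto
      ultimately obtain p where p: "p \<in> \<Delta>" "\<G> \<subseteq> p" unfolding V_def by auto
      have u: "p \<in> ultrafilters S" using p by (simp add: delta_iff)
      have "sg L \<inter> (S \<inter> \<Inter>\<G>) \<in> p"
        using ultrafilter_Int[OF u _ ultrafilter_Inter[OF u g(1) p(2)]] p L
        by (simp add: delta_iff)
      then show "sg L \<inter> \<Inter>\<G> \<noteq> {}" using ultrafilter_nonempty[OF u] by blast
    qed
    then have "V (\<Union>C) \<noteq> {}" unfolding V_def by blast
    moreover have "V (\<Union>C) = (\<Inter>\<F>\<in>C. V \<F>)" using C(1) unfolding V_def by blast
    moreover have "\<forall>\<F>\<in>C. \<F> \<subseteq> Pow S \<and> (\<forall>p\<in>V \<F>. \<forall>q\<in>\<Delta>. q \<star> p \<in> V \<F>)"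
      using CW unfolding W_def by blast
    moreover from this have "\<Union>C \<subseteq> Pow S" by blast
    ultimately show "\<Union>C \<in> W" unfolding W_def by simp
  qed
  then obtain \<F> where F: "\<F> \<in> W" and max: "\<And>X. X \<in> W \<Longrightarrow> \<F> \<subseteq> X \<Longrightarrow> X = \<F>" by blast
  obtain p where pV: "p \<in> V \<F>" using F unfolding W_def by blast
  then have p: "p \<in> \<Delta>" unfolding V_def by blast
  have "\<exists>r\<in>\<Delta>. r \<star> (q \<star> p) = p" if q: "q \<in> \<Delta>" for q
  proof -
    \<comment> \<open>\<open>\<H>\<close> encodes the closed left ideal
      \<open>\<Delta> \<star> (q \<star> p)\<close>, which is contained in \<open>V \<F>\<close>.
      Maximality of \<open>\<F>\<close> makes the two ideals equal, so \<open>p\<close> lies in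
      it.\<close>
    define \<H> where "\<H> = {A. A \<subseteq> S \<and> (\<forall>r\<in>\<Delta>. A \<in> r \<star> (q \<star> p))}"
    have qp: "q \<star> p \<in> \<Delta>" using uf_mult_closed q p by blast
    have VH: "V \<H> = {r \<star> (q \<star> p) | r. r \<in> \<Delta>}"
      using principal_left_ideal_closed[OF _ qp] uf_mult_closed qp
      unfolding V_def \<H>_def by blast
    have "\<H> \<in> W"
    proof -
      have "\<H> \<subseteq> Pow S" "V \<H> \<noteq> {}" using q unfolding VH by (auto simp: \<H>_def)
      moreover have "s \<star> (r \<star> (q \<star> p)) \<in> V \<H>" if "r \<in> \<Delta>" "s \<in> \<Delta>" for r s
        using uf_mult_assoc[OF qp, of s r, symmetric] uf_mult_closed[OF that(2,1)]
        unfolding VH by auto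
      then have "\<forall>p'\<in>V \<H>. \<forall>s\<in>\<Delta>. s \<star> p' \<in> V \<H>" using VH by auto
      ultimately show ?thesis unfolding W_def by blast
    qed
    moreover have "\<F> \<subseteq> \<H>"
    proof -
      have "r \<star> (q \<star> p) \<in> V \<F>" if "r \<in> \<Delta>" for r
        using F pV q that unfolding W_def by blast
      then have "\<F> \<subseteq> r \<star> (q \<star> p)" if "r \<in> \<Delta>" for r using that unfolding V_def by blast
      moreover have "\<F> \<subseteq> Pow S" using F unfolding W_def by blast
      ultimately show ?thesis unfolding \<H>_def by blast
    qed
    ultimately have "\<H> = \<F>" by (rule max)
    then have "p \<in> V \<H>" using pV by simp
    then show ?thesis using VH by auto
  qed
  then show ?thesis using p unfolding minimal_elements_def by blast
qed

text \<open>Witnesses are transported by associativity: for \<open>s \<star> p\<close> and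
  \<open>q\<close>, take \<open>s \<star> r\<close>, where \<open>r\<close> serves \<open>p\<close>
  and \<open>q \<star> s\<close>; for \<open>p \<star> s\<close>, the \<open>r\<close> that serves
  \<open>p\<close> and \<open>q\<close> works again.\<close>

lemma minimal_elements_ideal: "two_sided_ideal S mul minimal_elements"
proof -
  have "s \<star> p \<in> minimal_elements \<and> p \<star> s \<in> minimal_elements"
    if p: "p \<in> minimal_elements" and s: "s \<in> \<Delta>" for p s
  proof
    have pD: "p \<in> \<Delta>" using p unfolding minimal_elements_def by blast
    have "\<exists>r\<in>\<Delta>. r \<star> (q \<star> (s \<star> p)) = s \<star> p" if q: "q \<in> \<Delta>" for q
    proof -
      obtain r where r: "r \<in> \<Delta>" "r \<star> ((q \<star> s) \<star> p) = p"
        using p uf_mult_closed q s unfolding minimal_elements_def by blast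
      then have "(s \<star> r) \<star> (q \<star> (s \<star> p)) = s \<star> p"
        using uf_mult_assoc uf_mult_closed pD q s by metis
      then show ?thesis using uf_mult_closed r(1) s by blast
    qed
    then show "s \<star> p \<in> minimal_elements"
      unfolding minimal_elements_def using uf_mult_closed s pD by blast
    have "\<exists>r\<in>\<Delta>. r \<star> (q \<star> (p \<star> s)) = p \<star> s" if q: "q \<in> \<Delta>" for q
    proof -
      obtain r where r: "r \<in> \<Delta>" "r \<star> (q \<star> p) = p"
        using p q unfolding minimal_elements_def by blast
      then show ?thesis using uf_mult_assoc s by metis
    qed
    then show "p \<star> s \<in> minimal_elements"
      unfolding minimal_elements_def using uf_mult_closed s pD by blast
  qed
  then show ?thesis
    using minimal_elements_nonempty unfolding two_sided_ideal_def
    by (auto simp: minimal_elements_def)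
qed

text \<open>If \<open>i\<close> lies in an ideal \<open>I\<close>, then so does
  \<open>i \<star> p\<close>, and hence \<open>p = r \<star> (i \<star> p)\<close>.\<close>

lemma smallest_ideal_eq: "smallest_ideal S mul = minimal_elements"
  unfolding smallest_ideal_def
proof (rule Least_equality)
  show "two_sided_ideal S mul minimal_elements" by (rule minimal_elements_ideal)
  fix I assume I: "two_sided_ideal S mul I"
  show "minimal_elements \<le> I"
  proof
    fix p assume p: "p \<in> minimal_elements"
    obtain i where i: "i \<in> I" "i \<in> \<Delta>" using I unfolding two_sided_ideal_def by blast
    obtain r where "r \<in> \<Delta>" "r \<star> (i \<star> p) = p" "p \<in> \<Delta>"
      using p i unfolding minimal_elements_def by blast
    then show "p \<in> I" using I i unfolding two_sided_ideal_def by metis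
  qed
qed

text \<open>If every \<open>F\<close> failed, compactness would give a
  \<open>q \<in> \<Delta>\<close> containing all complements \<open>S - lq x B\<close>. But
  \<open>A \<in> p = r \<star> (q \<star> p)\<close> gives some \<open>x\<close> with
  \<open>lq x A \<in> q \<star> p\<close>, that is, \<open>lq x B \<in> q\<close>.\<close>

lemma minimal_element_syndetic:
  assumes p: "p \<in> minimal_elements" and A: "A \<in> p"
  shows "\<exists>F\<in>Pf S. \<forall>y\<in>sg F. \<exists>x u. mul x y = Some u \<and> lq u A \<in> p"
proof (rule ccontr)
  assume n: "\<not> ?thesis"
  have pD: "p \<in> \<Delta>" using p unfolding minimal_elements_def by blast
  define B where "B = {u \<in> S. lq u A \<in> p}"
  define \<F> where "\<F> = (\<lambda>x. S - lq x B) ` S"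
  have "\<exists>q\<in>\<Delta>. \<F> \<subseteq> q"
  proof (rule delta_extends)
    show "\<F> \<subseteq> Pow S" unfolding \<F>_def by auto
    fix \<G> L assume g: "\<G> \<subseteq> \<F>" and L: "L \<in> Pf S"
    \<comment> \<open>A point \<open>y\<close> at which \<open>L\<close> fails avoids every
      \<open>lq x B\<close>, so it lies in all members of \<open>\<F>\<close> at once.\<close>
    obtain y where y: "y \<in> sg L" "\<And>x u. mul x y = Some u \<Longrightarrow> lq u A \<notin> p" using n L by blast
    have "y \<in> S" using y L sigma_sub by (auto simp: Fpow_iff)
    moreover have "y \<notin> lq x B" for x using y by (auto simp: lq_iff B_def)
    ultimately have "y \<in> \<Inter>\<G>" using g unfolding \<F>_def by blast
    then show "sg L \<inter> \<Inter>\<G> \<noteq> {}" using y by blast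
  qed
  then obtain q where q: "q \<in> \<Delta>" "\<F> \<subseteq> q" by blast
  obtain r where r: "r \<in> \<Delta>" "r \<star> (q \<star> p) = p"
    using p q unfolding minimal_elements_def by blast
  then have "{x \<in> S. lq x A \<in> q \<star> p} \<in> r" using A uf_mult_iff by metis
  then obtain x where x: "x \<in> S" "lq x A \<in> q \<star> p"
    using ultrafilter_nonempty[OF delta_ultrafilter[OF r(1)]] by blast
  then have "lq x B \<in> q" using lq_uf_mult[OF pD x(1)] by (simp add: uf_mult_iff B_def)
  moreover have "S - lq x B \<in> q" using q(2) x(1) unfolding \<F>_def by blast
  ultimately show False using ultrafilter_Diff[OF delta_ultrafilter[OF q(1)] lq_sub] by blast
qed

section \<open>Products of words\<close>

text \<open>\<open>word_prod\<close> folds the second letter into the head, so the induction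
  generalizes over the head \<open>c\<close> and uses associativity once per letter.\<close>

lemma word_prod_mul_left:
  assumes "word_prod mul (c # ws) = Some w" "mul x w = Some u"
  shows "\<exists>d. mul x c = Some d \<and> word_prod mul (d # ws) = Some u"
  using assms
proof (induction ws arbitrary: c)
  case (Cons e ws)
  then obtain v where v: "mul c e = Some v" "word_prod mul (v # ws) = Some w"
    by (auto simp: bind_eq_Some_conv)
  then obtain d' where d': "mul x v = Some d'" "word_prod mul (d' # ws) = Some u"
    using Cons by blast
  have "x \<in> S" "c \<in> S" "e \<in> S" using v d' mul_closed by blast+
  then have "Option.bind (mul x c) (\<lambda>u. mul u e) = Some d'" using assoc v d' by simp
  then show ?case using d' by (auto simp: bind_eq_Some_conv)
qed simp

lemma word_prod_snoc:
  "ws \<noteq> [] \<Longrightarrow> word_prod mul (ws @ [c]) = Option.bind (word_prod mul ws) (\<lambda>v. mul v c)"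
  by (induction mul ws rule: word_prod.induct) (auto split: Option.bind_splits)

text \<open>With the last letter split off by \<open>word_prod_snoc\<close>, a single use of
  associativity suffices.\<close>

lemma word_prod_mul_right:
  assumes "word_prod mul (ws @ [c]) = Some w" "mul w z = Some u"
  shows "\<exists>d. mul c z = Some d \<and> word_prod mul (ws @ [d]) = Some u"
proof (cases "ws = []")
  case False
  then obtain v where v: "word_prod mul ws = Some v" "mul v c = Some w"
    using assms(1) by (auto simp: word_prod_snoc bind_eq_Some_conv)
  have "v \<in> S" "c \<in> S" "z \<in> S" using v assms(2) mul_closed by blast+
  then have "Option.bind (mul c z) (\<lambda>d. mul v d) = Some u" using assoc v assms(2) by force
  then show ?thesis using False v by (auto simp: word_prod_snoc bind_eq_Some_conv)
qed (use assms in simp)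

text \<open>The witness changes \<open>a\<close> only at its two ends, to \<open>x * a 1\<close> and
  \<open>a (m + 1) * z\<close>. These positions are distinct because
  \<open>1 \<le> m\<close>.\<close>

lemma alternating_word_absorb:
  fixes a f :: "nat \<Rightarrow> 'a"
  defines "W \<equiv> \<lambda>m t a. concat (map (\<lambda>i. [a i, f (t i)]) [1..<m + 1]) @ [a (m + 1)]"
  assumes m: "1 \<le> m" and a: "a \<in> {1..m + 1} \<rightarrow> S"
    and w: "word_prod mul (W m t a) = Some w" and u: "mul x w = Some u" and s: "mul u z = Some s"
  shows "\<exists>b \<in> {1..m + 1} \<rightarrow> S. word_prod mul (W m t b) = Some s"
proof -
  have W: "W m t b = b 1 # (f (t 1) # concat (map (\<lambda>i. [b i, f (t i)]) [2..<m + 1])) @ [b (m + 1)]"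
    for b
  proof -
    have "[1..<m + 1] = 1 # [2..<m + 1]"
      using m upt_conv_Cons[of 1 "m + 1"] by (simp add: numeral_2_eq_2)
    then show ?thesis unfolding W_def by simp
  qed
  define ws where "ws = f (t 1) # concat (map (\<lambda>i. [a i, f (t i)]) [2..<m + 1])"
  obtain d where d: "mul x (a 1) = Some d" "word_prod mul (d # ws @ [a (m + 1)]) = Some u"
    using word_prod_mul_left[OF _ u, of "a 1" "ws @ [a (m + 1)]"] w unfolding W ws_def by auto
  obtain e where e: "mul (a (m + 1)) z = Some e" "word_prod mul ((d # ws) @ [e]) = Some s"
    using word_prod_mul_right[OF _ s, of "d # ws" "a (m + 1)"] d(2) by auto
  define b where "b = a(1 := d, m + 1 := e)"
  have b: "b 1 = d" "b (m + 1) = e" using m by (auto simp: b_def)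
  \<comment> \<open>The interior indices run from \<open>2\<close> to \<open>m\<close> and so avoid
    both changed positions.\<close>
  have eq: "map (\<lambda>i. [b i, f (t i)]) [2..<m + 1] = map (\<lambda>i. [a i, f (t i)]) [2..<m + 1]"
    by (rule map_cong) (auto simp: b_def)
  have "W m t b = (d # ws) @ [e]" unfolding W ws_def b eq by simp
  then have "word_prod mul (W m t b) = Some s" using e(2) by (simp only:)
  moreover have "b \<in> {1..m + 1} \<rightarrow> S"
    using a mul_closed[OF d(1)] mul_closed[OF e(1)] unfolding b_def by auto
  ultimately show ?thesis by blast
qed

end

section \<open>Transfer of the 1-CR property from \<open>S\<close> to \<open>A\<close>\<close>

theorem theorem3p6:
  fixes S :: "'a set" and mul :: "'a \<Rightarrow> 'a \<Rightarrow> 'a option" and A :: "'a set"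
  assumes "adequate_partial_semigroup S mul"
    and "CR_set S mul 1 S"
    and "piecewise_syndetic S mul A"
  shows "CR_set S mul 1 A"
proof -
  interpret adequate_partial_semigroup S mul by fact
  obtain p where p: "p \<in> minimal_elements" "A \<in> p"
    using assms(3) unfolding piecewise_syndetic_def smallest_ideal_eq uf_closure_def by blast
  have pD: "p \<in> \<Delta>" using p(1) unfolding minimal_elements_def by blast
  have pU: "p \<in> ultrafilters S" using delta_ultrafilter[OF pD] .
  let ?word = "\<lambda>m a t f. concat (map (\<lambda>i. [a i, f (t i)]) [1..<m + 1]) @ [a (m + 1)]"
  let ?CR = "\<lambda>X L r F. \<exists>m \<in> {1..}. \<exists>a \<in> {1..m + 1} \<rightarrow> S. \<exists>t \<in> {1..m} \<rightarrow> {1..r}.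
    strict_mono_on {1..m} t \<and>
    (\<forall>f \<in> F. \<exists>s \<in> X \<inter> sg L. word_prod mul (?word m a t f) = Some s)"
  have "\<exists>r \<in> {1..}. \<forall>G \<in> Pf (adequate_seqs S mul). card G \<le> 1 \<longrightarrow> ?CR A L r G"
    if L: "L \<in> Pf S" for L
  proof -
    have "A \<inter> sg L \<in> p" using ultrafilter_Int[OF pU p(2)] pD L by (simp add: delta_iff)
    from minimal_element_syndetic[OF p(1) this] obtain F where F: "F \<in> Pf S"
      and syn: "\<forall>y\<in>sg F. \<exists>x u. mul x y = Some u \<and> lq u (A \<inter> sg L) \<in> p"
      by (rule bexE)
    have "\<forall>L \<in> Pf S. \<exists>r \<in> {1..}. \<forall>G \<in> Pf (adequate_seqs S mul). card G \<le> 1 \<longrightarrow> ?CR S L r G"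
      using assms(2) unfolding CR_set_def by (rule conjunct2)
    \<comment> \<open>The property of \<open>S\<close> is applied with \<open>F\<close> in place of
      \<open>L\<close>; membership of the final product in \<open>sg L\<close> will come from
      \<open>A \<inter> sg L\<close>. The bound \<open>r\<close> is fixed before \<open>G\<close> is
      given.\<close>
    from bspec[OF this F] obtain r where r: "r \<in> {1..}"
      and CR: "\<forall>G \<in> Pf (adequate_seqs S mul). card G \<le> 1 \<longrightarrow> ?CR S F r G"
      by (rule bexE)
    have "?CR A L r G" if G: "G \<in> Pf (adequate_seqs S mul)" "card G \<le> 1" for G
    proof -
      have "finite G" "G \<noteq> {}" using G(1) by (auto simp: Fpow_def)
      then have "card G = 1" using G(2) by (simp add: le_Suc_eq)
      \<comment> \<open>The factors \<open>x\<close> and \<open>z\<close> below depend on the value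
        of the word, hence on the sequence. As \<open>G\<close> is a singleton, one modified
        \<open>a\<close> serves all of \<open>G\<close>.\<close>
      then obtain f where f: "G = {f}" by (rule card_1_singletonE)
      obtain m a t y where m: "m \<in> {1..}" and a: "a \<in> {1..m + 1} \<rightarrow> S"
        and t: "t \<in> {1..m} \<rightarrow> {1..r}" "strict_mono_on {1..m} t"
        and y: "y \<in> sg F" "word_prod mul (?word m a t f) = Some y"
        using bspec[OF CR G(1), THEN mp, OF G(2)] unfolding f by blast
      obtain x u where u: "mul x y = Some u" "lq u (A \<inter> sg L) \<in> p" using syn y(1) by blast
      obtain z where "z \<in> lq u (A \<inter> sg L)" using ultrafilter_nonempty[OF pU u(2)] by blast
      then obtain s where s: "mul u z = Some s" "s \<in> A \<inter> sg L" unfolding lq_iff by blast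
      have "1 \<le> m" using m by simp
      from alternating_word_absorb[of m a f t y x u z s, OF this a y(2) u(1) s(1)]
      obtain b where b: "b \<in> {1..m + 1} \<rightarrow> S" "word_prod mul (?word m b t f) = Some s"
        by (rule bexE)
      have "strict_mono_on {1..m} t \<and>
          (\<forall>f \<in> G. \<exists>s \<in> A \<inter> sg L. word_prod mul (?word m b t f) = Some s)"
        using t(2) b(2) s(2) unfolding f by blast
      then show ?thesis using m b(1) t(1) by blast
    qed
    then show ?thesis using r by blast
  qed
  moreover have "A \<subseteq> S" using ultrafilter_sub[OF pU p(2)] .
  ultimately show ?thesis unfolding CR_set_def by blast
qed

end
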